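(* There is a constant $c\le \log 12<3.585$ such that for all integers $n$ and $\ell,k$ with $1\le \ell\le n-1$, $0\le k\le n-1$ and $\ell\neq k$, \[\operatorname{ldim}\big(Q_n^{\ell,k}\big)\ \ge\ \frac{\log\binom{n}{k}}{\log\binom{n}{\ell}} - \frac{\log\binom{n}{k}}{\big(\log\binom{n}{\ell}\big)^2}\left(\log\log\binom{n}{\ell}+c\right).\] In particular, as $n\to\infty$, uniformly in $k$, \[\operatorname{ldim}\big(Q_n^{1,k}\big)\ \ge\ \left(\frac{1}{\log n}-O\!\left(\frac{\log\log n}{(\log n)^2}\right)\right)\log\binom{n}{k}.\]
   Context: Logarithms are base 2. For distinct $\ell,k\in\{0,\dots,n\}$, $Q_n^{\ell,k}$ denotes the poset consisting of all $\ell$-element and all $k$-element subsets of $[n]$, ordered by inclusion. For a poset $P=(X,\le)$, a partial linear extension is a linear order $L=(Y,\le_L)$ with $Y\subseteq X$ such that $x\le y$ implies $x\le_L y$ for $x,y\in Y$. A local realiser is a set $\mathcal{L}$ of partial linear extensions such that for every ordered pair $(x,y)$ with $x\not\ge y$ some $L\in\mathcal{L}$ contains both and has $x\le_L y$. The multiplicity $\mu_{\mathcal{L}}(x)$ is the number of members of $\mathcal{L}$ containing $x$; the local dimension $\operatorname{ldim}(P)$ is the minimum over local realisers of $\max_x\mu_{\mathcal{L}}(x)$. *)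

theory Defs
  imports Complex_Main "HOL-Library.Landau_Symbols"
begin

text \<open>
  A poset is given by its reflexive order relation \<open>P\<close>; its ground set is \<open>Field P\<close>.
  Likewise a linear order \<open>(Y, \<le>\<^sub>L)\<close> is given by the relation \<open>L\<close>, with \<open>Y = Field L\<close>.
\<close>

definition partial_linear_extension :: "'a rel \<Rightarrow> 'a rel \<Rightarrow> bool" where
  "partial_linear_extension P L \<longleftrightarrow>
     Linear_order L \<and> Field L \<subseteq> Field P \<and>
     (\<forall>x\<in>Field L. \<forall>y\<in>Field L. (x, y) \<in> P \<longrightarrow> (x, y) \<in> L)"

definition local_realiser :: "'a rel \<Rightarrow> 'a rel set \<Rightarrow> bool" where
  "local_realiser P \<L> \<longleftrightarrow>
     (\<forall>L\<in>\<L>. partial_linear_extension P L) \<and>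
     (\<forall>x\<in>Field P. \<forall>y\<in>Field P. (y, x) \<notin> P \<longrightarrow>
        (\<exists>L\<in>\<L>. x \<in> Field L \<and> y \<in> Field L \<and> (x, y) \<in> L))"

definition multiplicity_in :: "'a rel set \<Rightarrow> 'a \<Rightarrow> nat" where
  "multiplicity_in \<L> x = card {L \<in> \<L>. x \<in> Field L}"

text \<open>
  Meant for posets with finite non-empty ground set: then every local realiser is finite,
  so the cardinality and the maximum below have their usual meaning, and the minimum is
  over a non-empty set by \<open>ex_local_realiser\<close>.
\<close>

definition ldim :: "'a rel \<Rightarrow> nat" where
  "ldim P = (LEAST d. \<exists>\<L>. local_realiser P \<L> \<and> d = Max (multiplicity_in \<L> ` Field P))"

definition layer_poset :: "nat \<Rightarrow> nat \<Rightarrow> nat \<Rightarrow> nat set rel" where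
  "layer_poset n l k =
     (let X = {A. A \<subseteq> {1..n} \<and> (card A = l \<or> card A = k)}
      in {(A, B). A \<in> X \<and> B \<in> X \<and> A \<subseteq> B})"

lemma Field_layer_poset:
  "Field (layer_poset n l k) = {A. A \<subseteq> {1..n} \<and> (card A = l \<or> card A = k)}"
  by (auto simp: layer_poset_def Field_def)

lemma Partial_order_layer_poset: "Partial_order (layer_poset n l k)"
  unfolding partial_order_on_def preorder_on_def Field_layer_poset
  by (auto simp: layer_poset_def refl_on_def trans_def antisym_def)

lemma finite_Field_layer_poset: "finite (Field (layer_poset n l k))"
  unfolding Field_layer_poset by (rule finite_subset[of _ "Pow {1..n}"]) auto

lemma ex_local_realiser:
  "\<exists>\<L>. local_realiser P \<L>"
proof -
  define pair :: "'a \<Rightarrow> 'a \<Rightarrow> 'a rel" where "pair x y = {(x, x), (x, y), (y, y)}" for x y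
  have F: "Field (pair x y) = {x, y}" for x y
    by (auto simp: Field_def pair_def)
  have M: "(a, b) \<in> pair x y \<longleftrightarrow> a = x \<and> (b = x \<or> b = y) \<or> a = y \<and> b = y" for a b x y
    by (auto simp: pair_def)
  have "Linear_order (pair x y)" for x y
    unfolding linear_order_on_def partial_order_on_def preorder_on_def F
  proof (intro conjI)
    show "pair x y \<subseteq> {x, y} \<times> {x, y}" by (auto simp: pair_def)
    show "refl_on {x, y} (pair x y)" unfolding refl_on_def M by blast
    show "trans (pair x y)" unfolding trans_def M by blast
    show "antisym (pair x y)" unfolding antisym_def M by blast
    show "total_on {x, y} (pair x y)" unfolding total_on_def M by blast
  qed
  then have ple: "partial_linear_extension P (pair x y)"
    if "x \<in> Field P" "y \<in> Field P" "(y, x) \<notin> P" for x y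
    using that unfolding partial_linear_extension_def F M by blast
  have "local_realiser P
      {L. \<exists>x y. L = pair x y \<and> x \<in> Field P \<and> y \<in> Field P \<and> (y, x) \<notin> P}" (is "local_realiser P ?R")
    unfolding local_realiser_def
  proof (intro conjI ballI impI)
    fix L assume "L \<in> ?R"
    then show "partial_linear_extension P L" using ple by blast
  next
    fix x y assume "x \<in> Field P" "y \<in> Field P" "(y, x) \<notin> P"
    then have "pair x y \<in> ?R" by blast
    moreover have "x \<in> Field (pair x y)" "y \<in> Field (pair x y)" "(x, y) \<in> pair x y"
      unfolding F M by blast+
    ultimately show "\<exists>L\<in>?R. x \<in> Field L \<and> y \<in> Field L \<and> (x, y) \<in> L" by blast
  qed
  then show ?thesis ..
qed

end

theory Submission
  imports Defs "HOL-Real_Asymp.Real_Asymp"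
begin

text \<open>
  Fix a local realiser of multiplicity \<open>d\<close> and let \<open>X\<close> be the \<open>l\<close>-layer, \<open>N = card X\<close>.
  A \<open>k\<close>-set is determined by its comparabilities with \<open>X\<close>, hence by the positions at which it is
  inserted into \<open>X \<inter> Field L\<close> for the at most \<open>d\<close> members \<open>L\<close> that contain it. A non-empty
  \<open>X \<inter> Field L\<close> offers \<open>card (X \<inter> Field L) + 1 \<le> 2 * card (X \<inter> Field L)\<close> positions, so by double
  counting there are at most \<open>2 * N * d\<close> positions altogether, and a set of that size has at most
  \<open>(2 * e * N) ^ d\<close> subsets with at most \<open>d\<close> elements. Thus
  \<open>log (n choose k) \<le> d * (log N + log (2 * e))\<close>, and \<open>m / (a + b) \<ge> m / a - m * b / a\<^sup>2\<close>
  together with \<open>2 * e \<le> 12\<close> gives the bound, even without the term \<open>log log N \<ge> 0\<close>.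
\<close>

section \<open>Counting chains and small subsets\<close>

text \<open>Nested finite sets of equal size coincide, so \<open>card\<close> embeds the chain into
  \<open>{..card Y}\<close>.\<close>

lemma card_chain_le:
  assumes "finite Y" and sub: "\<And>S. S \<in> C \<Longrightarrow> S \<subseteq> Y"
    and chain: "\<And>S T. S \<in> C \<Longrightarrow> T \<in> C \<Longrightarrow> S \<subseteq> T \<or> T \<subseteq> S"
  shows "card C \<le> card Y + 1"
proof -
  have fin: "finite S" if "S \<in> C" for S
    using sub[OF that] \<open>finite Y\<close> finite_subset by blast
  have "inj_on card C"
  proof (rule inj_onI)
    fix S T assume "S \<in> C" "T \<in> C" "card S = card T"
    then show "S = T"
      using chain[of S T] fin[of S] fin[of T] card_subset_eq[of S T] card_subset_eq[of T S] by auto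
  qed
  moreover have "card ` C \<subseteq> {..card Y}"
    using sub \<open>finite Y\<close> by (auto intro: card_mono)
  ultimately have "card C \<le> card {..card Y}"
    by (intro card_inj_on_le) auto
  then show ?thesis by simp
qed

text \<open>Chernoff's argument: each counted set has weight at least \<open>(1 / m) ^ d\<close> in the expansion of
  \<open>(1 + 1 / m) ^ card T\<close>.\<close>

lemma card_small_subsets_le:
  fixes m :: real
  assumes "finite T" "m \<ge> 1" and T: "real (card T) \<le> m * real d"
  shows "real (card {S. S \<subseteq> T \<and> card S \<le> d}) \<le> (exp 1 * m) ^ d"
proof -
  let ?F = "{S. S \<subseteq> T \<and> card S \<le> d}"
  define x where "x = 1 / m"
  have x: "0 < x" "x \<le> 1" using \<open>m \<ge> 1\<close> by (auto simp: x_def)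
  have "real (card ?F) * x ^ d = (\<Sum>S\<in>?F. x ^ d)" by simp
  also have "\<dots> \<le> (\<Sum>S\<in>?F. x ^ card S)"
    using x by (intro sum_mono power_decreasing) auto
  also have "\<dots> \<le> (\<Sum>S\<in>Pow T. x ^ card S)"
    using x \<open>finite T\<close> by (intro sum_mono2) auto
  also have "\<dots> = (x + 1) ^ card T"
    using prod_add[OF \<open>finite T\<close>, of "\<lambda>_. x" "\<lambda>_. 1"] by simp
  also have "\<dots> \<le> exp x ^ card T"
    using x exp_ge_add_one_self[of x] by (intro power_mono) (auto simp: add.commute)
  also have "\<dots> = exp (real (card T) * x)" by (simp add: exp_of_nat_mult)
  also have "\<dots> \<le> exp (real d)"
    using T \<open>m \<ge> 1\<close> by (simp add: x_def field_simps)
  finally have "real (card ?F) \<le> exp (real d) * m ^ d"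
    using \<open>m \<ge> 1\<close> by (simp add: x_def field_simps)
  also have "exp (real d) = exp 1 ^ d" using exp_of_nat_mult[of d "1::real"] by simp
  finally show ?thesis by (simp add: power_mult_distrib)
qed

section \<open>Local realisers and the counting bound\<close>

text \<open>Both sides count the pairs \<open>(x, L)\<close> with \<open>x\<close> in
  \<open>X \<inter> Field L\<close>.\<close>

lemma sum_card_inter_Field:
  assumes "finite \<L>" "finite X"
  shows "(\<Sum>L\<in>\<L>. card (X \<inter> Field L)) = (\<Sum>x\<in>X. multiplicity_in \<L> x)"
proof -
  have "(\<Sum>L\<in>\<L>. card (X \<inter> Field L)) = (\<Sum>L\<in>\<L>. \<Sum>x\<in>X. if x \<in> Field L then 1 else 0)"
    using assms by (simp add: sum.If_cases Int_def)
  also have "\<dots> = (\<Sum>x\<in>X. \<Sum>L\<in>\<L>. if x \<in> Field L then 1 else 0)" by (rule sum.swap)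
  also have "\<dots> = (\<Sum>x\<in>X. multiplicity_in \<L> x)"
    using assms by (simp add: sum.If_cases multiplicity_in_def Int_def)
  finally show ?thesis .
qed

lemma finite_local_realiser:
  assumes "finite (Field P)" "local_realiser P \<L>"
  shows "finite \<L>"
proof (rule finite_subset)
  show "\<L> \<subseteq> Pow (Field P \<times> Field P)"
    using assms(2) FieldI1 FieldI2
    unfolding local_realiser_def partial_linear_extension_def by fastforce
qed (use assms(1) in simp)

lemma ldim_attained:
  assumes "finite (Field P)"
  obtains \<L> where "local_realiser P \<L>" "\<And>x. x \<in> Field P \<Longrightarrow> multiplicity_in \<L> x \<le> ldim P"
proof -
  have "\<exists>d \<L>. local_realiser P \<L> \<and> d = Max (multiplicity_in \<L> ` Field P)"
    using ex_local_realiser by blast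
  then have "\<exists>\<L>. local_realiser P \<L> \<and> ldim P = Max (multiplicity_in \<L> ` Field P)"
    unfolding ldim_def by (rule LeastI_ex)
  with that assms show ?thesis by fastforce
qed

text \<open>The counting argument for a general poset. The disjunction in \<open>sep\<close> lets
  \<open>X\<close> lie below or above \<open>Y\<close>, so the cases \<open>l < k\<close> and
  \<open>k < l\<close> need no separate count.\<close>

lemma card_separated_le:
  assumes fin: "finite (Field P)" and XY: "X \<subseteq> Field P" "Y \<subseteq> Field P" "X \<inter> Y = {}" and "X \<noteq> {}"
    and sep: "\<And>b b'. b \<in> Y \<Longrightarrow> b' \<in> Y \<Longrightarrow> b \<noteq> b' \<Longrightarrow>
      \<exists>a\<in>X. (a, b) \<in> P \<and> (a, b') \<notin> P \<or> (b, a) \<in> P \<and> (b', a) \<notin> P"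
  shows "real (card Y) \<le> (exp 1 * (2 * real (card X))) ^ ldim P"
proof -
  obtain \<L> where \<L>: "local_realiser P \<L>" "\<And>x. x \<in> Field P \<Longrightarrow> multiplicity_in \<L> x \<le> ldim P"
    using ldim_attained[OF fin] by blast
  have fin\<L>: "finite \<L>" using finite_local_realiser[OF fin \<L>(1)] .
  have finX: "finite X" using XY fin by (auto intro: finite_subset)
  have ple: "partial_linear_extension P L" if "L \<in> \<L>" for L
    using \<L>(1) that by (auto simp: local_realiser_def)
  have real: "\<exists>L\<in>\<L>. x \<in> Field L \<and> y \<in> Field L \<and> (x, y) \<in> L"
    if "x \<in> Field P" "y \<in> Field P" "(y, x) \<notin> P" for x y
    using \<L>(1) that by (auto simp: local_realiser_def)
  \<comment> \<open>Only members meeting \<open>X\<close> are kept: for these the \<open>+ 1\<close>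
    of \<open>card_chain_le\<close> is absorbed into the factor 2.\<close>
  define M where "M = {L \<in> \<L>. X \<inter> Field L \<noteq> {}}"
  define pos where "pos L b = {a \<in> X \<inter> Field L. (a, b) \<in> L}" for L b
  define T where "T = (SIGMA L:M. pos L ` Field L)"
  \<comment> \<open>Tagging each position with its \<open>L\<close> keeps equal cuts in different
    members apart; it also records which members of \<open>M\<close> contain
    \<open>b\<close>.\<close>
  define code where "code b = (\<lambda>L. (L, pos L b)) ` {L \<in> M. b \<in> Field L}" for b
  have finM: "finite M" using fin\<L> by (simp add: M_def)
  have finF: "finite (Field L)" if "L \<in> M" for L
    using ple[of L] that fin finite_subset by (auto simp: M_def partial_linear_extension_def)
  have finT: "finite T" unfolding T_def using finM finF by auto
  have pos_card: "card (pos L ` Field L) \<le> 2 * card (X \<inter> Field L)" if "L \<in> M" for L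
  proof -
    have lin: "Linear_order L" using ple[of L] that
      by (auto simp: M_def partial_linear_extension_def)
    have "card (pos L ` Field L) \<le> card (X \<inter> Field L) + 1"
    \<comment> \<open>The sets \<open>pos L b\<close> are initial segments of
      \<open>X \<inter> Field L\<close>, hence nested.\<close>
    proof (rule card_chain_le)
      fix S S' assume "S \<in> pos L ` Field L" "S' \<in> pos L ` Field L"
      then obtain b b' where b: "b \<in> Field L" "b' \<in> Field L" "S = pos L b" "S' = pos L b'" by auto
      have "(b, b') \<in> L \<or> (b', b) \<in> L"
        using lin b(1,2) unfolding linear_order_on_def partial_order_on_def preorder_on_def
        by (cases "b = b'") (auto simp: refl_on_def total_on_def)
      moreover have "trans L" using lin
        by (simp add: linear_order_on_def partial_order_on_def preorder_on_def)
      ultimately show "S \<subseteq> S' \<or> S' \<subseteq> S"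
        unfolding b pos_def by (blast dest: transD)
    qed (use finX in \<open>auto simp: pos_def\<close>)
    moreover have "card (X \<inter> Field L) \<ge> 1"
      using that finX by (simp add: M_def card_gt_0_iff Suc_le_eq)
    ultimately show ?thesis by linarith
  qed
  have "card T = (\<Sum>L\<in>M. card (pos L ` Field L))"
    unfolding T_def using finM finF by (intro card_SigmaI) auto
  also have "\<dots> \<le> (\<Sum>L\<in>M. 2 * card (X \<inter> Field L))" by (intro sum_mono pos_card)
  also have "\<dots> \<le> (\<Sum>L\<in>\<L>. 2 * card (X \<inter> Field L))"
    using fin\<L> by (intro sum_mono2) (auto simp: M_def)
  also have "\<dots> = 2 * (\<Sum>x\<in>X. multiplicity_in \<L> x)"
    using sum_card_inter_Field[OF fin\<L> finX] by (simp flip: sum_distrib_left)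
  also have "\<dots> \<le> 2 * (\<Sum>x\<in>X. ldim P)"
    using \<L>(2) XY(1) by (intro mult_left_mono sum_mono) auto
  finally have "card T \<le> 2 * card X * ldim P" by simp
  then have cardT: "real (card T) \<le> 2 * real (card X) * real (ldim P)"
    by (metis of_nat_le_iff of_nat_mult of_nat_numeral)
  have code: "code ` Y \<subseteq> {S. S \<subseteq> T \<and> card S \<le> ldim P}"
  proof (clarify, intro conjI)
    fix b assume "b \<in> Y"
    show "code b \<subseteq> T" by (auto simp: code_def T_def)
    have "card (code b) \<le> card {L \<in> M. b \<in> Field L}"
      unfolding code_def using finM by (intro card_image_le) auto
    also have "\<dots> \<le> multiplicity_in \<L> b"
      unfolding multiplicity_in_def using fin\<L> by (intro card_mono) (auto simp: M_def)
    also have "\<dots> \<le> ldim P" using \<L>(2) \<open>b \<in> Y\<close> XY(2) by auto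
    finally show "card (code b) \<le> ldim P" .
  qed
  have "inj_on code Y"
  proof (rule inj_onI, rule ccontr)
    fix b b' assume b: "b \<in> Y" "b' \<in> Y" "b \<noteq> b'" and eq: "code b = code b'"
    \<comment> \<open>The tags force \<open>b\<close> into every member that contains
      \<open>b'\<close> and meets \<open>X\<close>, with the same cut there.\<close>
    have same: "b \<in> Field L \<and> pos L b = pos L b'" if "L \<in> \<L>" "b' \<in> Field L" "a \<in> X" "a \<in> Field L"
      for L a
    proof -
      have "(L, pos L b') \<in> code b'" using that by (auto simp: code_def M_def)
      then show ?thesis unfolding eq[symmetric] by (auto simp: code_def)
    qed
    obtain a where a: "a \<in> X" "(a, b) \<in> P \<and> (a, b') \<notin> P \<or> (b, a) \<in> P \<and> (b', a) \<notin> P"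
      using sep[OF b] by blast
    have ne: "a \<noteq> b" "a \<noteq> b'" using a(1) b XY(3) by auto
    have P: "a \<in> Field P" "b' \<in> Field P" using a(1) b XY by auto
    have anti: "antisym L" if "L \<in> \<L>" for L
      using ple[OF that] by (simp add: partial_linear_extension_def linear_order_on_def
          partial_order_on_def)
    from a(2) show False
    proof
      assume ab: "(a, b) \<in> P \<and> (a, b') \<notin> P"
      \<comment> \<open>This \<open>L\<close> places \<open>b'\<close> below \<open>a\<close>. Since
        \<open>b\<close> makes the same cut, \<open>a\<close> is not below \<open>b\<close> in
        \<open>L\<close>, although \<open>L\<close> extends \<open>P\<close>.\<close>
      then obtain L where L: "L \<in> \<L>" "a \<in> Field L" "b' \<in> Field L" "(b', a) \<in> L"
        using real[of b' a] P by blast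
      then have "b \<in> Field L" "pos L b = pos L b'" using same a(1) by auto
      moreover have "(a, b') \<notin> L" using L anti ne antisymD by fast
      ultimately have "(a, b) \<notin> L" using L a(1) by (auto simp: pos_def)
      with ab L \<open>b \<in> Field L\<close> ple[OF L(1)] show False
        by (auto simp: partial_linear_extension_def)
    next
      assume ab: "(b, a) \<in> P \<and> (b', a) \<notin> P"
      \<comment> \<open>Dually, \<open>a\<close> lies below \<open>b'\<close> and hence below
        \<open>b\<close> in \<open>L\<close>, while \<open>P\<close> forces \<open>b\<close> below
        \<open>a\<close>.\<close>
      then obtain L where L: "L \<in> \<L>" "a \<in> Field L" "b' \<in> Field L" "(a, b') \<in> L"
        using real[of a b'] P by blast
      then have "b \<in> Field L" "pos L b = pos L b'" using same a(1) by auto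
      with L a(1) have "(a, b) \<in> L" by (auto simp: pos_def)
      moreover have "(b, a) \<in> L"
        using ab L \<open>b \<in> Field L\<close> ple[OF L(1)] by (auto simp: partial_linear_extension_def)
      ultimately show False using L anti ne antisymD by fast
    qed
  qed
  then have "card Y \<le> card {S. S \<subseteq> T \<and> card S \<le> ldim P}"
    using code finT by (intro card_inj_on_le[of code]) auto
  also have "real \<dots> \<le> (exp 1 * (2 * real (card X))) ^ ldim P"
  proof (rule card_small_subsets_le[OF finT _ cardT])
    have "card X \<ge> 1" using finX \<open>X \<noteq> {}\<close> by (simp add: card_gt_0_iff Suc_le_eq)
    then show "1 \<le> 2 * real (card X)" by linarith
  qed
  finally show ?thesis by simp
qed

section \<open>Separating and bounding layers of the Boolean lattice\<close>

text \<open>For \<open>l < k\<close>, some \<open>l\<close>-set inside \<open>b\<close> contains a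
  point of \<open>b - b'\<close>; for \<open>k < l\<close>, some \<open>l\<close>-set around
  \<open>b\<close> avoids a point of \<open>b' - b\<close>. The former uses
  \<open>1 \<le> l\<close>, the latter \<open>l \<le> n - 1\<close>.\<close>

lemma layers_separated:
  assumes "1 \<le> l" "l < n" "l \<noteq> k"
    and b: "b \<subseteq> {1..n}" "card b = k" "b' \<subseteq> {1..n}" "card b' = k" "b \<noteq> b'"
  shows "\<exists>a. a \<subseteq> {1..n} \<and> card a = l \<and> (a \<subseteq> b \<and> \<not> a \<subseteq> b' \<or> b \<subseteq> a \<and> \<not> b' \<subseteq> a)"
proof -
  have fin: "finite b" "finite b'" using b finite_subset by auto
  show ?thesis
  proof (cases "l < k")
    case True
    obtain x where x: "x \<in> b" "x \<notin> b'" using b fin card_subset_eq[of b' b] by auto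
    obtain a where "{x} \<subseteq> a" "a \<subseteq> b" "card a = l"
      using exists_subset_between[of "{x}" l b] x assms True fin by auto
    then show ?thesis using x b by blast
  next
    case False
    obtain x where x: "x \<in> b'" "x \<notin> b" using b fin card_subset_eq[of b b'] by auto
    have "card ({1..n} - {x}) = n - 1" using x b by auto
    moreover have "b \<subseteq> {1..n} - {x}" using x b by blast
    ultimately obtain a where "b \<subseteq> a" "a \<subseteq> {1..n} - {x}" "card a = l"
      using exists_subset_between[of b l "{1..n} - {x}"] assms(2) b(2) False by fastforce
    then show ?thesis using x b by blast
  qed
qed

lemma choose_le_power_ldim_layer_poset:
  assumes "1 \<le> l" "l < n" "l \<noteq> k"
  shows "real (n choose k) \<le> (exp 1 * (2 * real (n choose l))) ^ ldim (layer_poset n l k)"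
proof -
  define layer where "layer j = {A. A \<subseteq> {1..n} \<and> card A = j}" for j
  have card: "card (layer j) = n choose j" for j
    unfolding layer_def using n_subsets[of "{1..n}" j] by simp
  have "card (layer l) > 0" using card[of l] assms by simp
  then have "layer l \<noteq> {}" by force
  have "real (card (layer k)) \<le> (exp 1 * (2 * real (card (layer l)))) ^ ldim (layer_poset n l k)"
  proof (rule card_separated_le[OF finite_Field_layer_poset])
    show "layer l \<inter> layer k = {}" using \<open>l \<noteq> k\<close> by (auto simp: layer_def)
    show "\<exists>a\<in>layer l. (a, b) \<in> layer_poset n l k \<and> (a, b') \<notin> layer_poset n l k \<or>
        (b, a) \<in> layer_poset n l k \<and> (b', a) \<notin> layer_poset n l k"
      if "b \<in> layer k" "b' \<in> layer k" "b \<noteq> b'" for b b'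
    proof -
      have b: "b \<subseteq> {1..n}" "card b = k" "b' \<subseteq> {1..n}" "card b' = k"
        using that by (auto simp: layer_def)
      obtain a where "a \<subseteq> {1..n}" "card a = l" "a \<subseteq> b \<and> \<not> a \<subseteq> b' \<or> b \<subseteq> a \<and> \<not> b' \<subseteq> a"
        using layers_separated[OF assms b \<open>b \<noteq> b'\<close>] by blast
      with b show ?thesis
        by (intro bexI[of _ a]) (auto simp: layer_def layer_poset_def)
    qed
  qed (use \<open>layer l \<noteq> {}\<close> in \<open>auto simp: layer_def Field_layer_poset\<close>)
  then show ?thesis by (simp only: card)
qed

section \<open>Logarithmic form and asymptotics\<close>

lemma ldim_layer_poset_ge:
  assumes "1 \<le> l" "l < n" "k < n" "l \<noteq> k"
  shows "log 2 (real (n choose k)) / log 2 (real (n choose l))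
           - log 2 (real (n choose k)) / (log 2 (real (n choose l)))\<^sup>2
             * (log 2 (log 2 (real (n choose l))) + log 2 12)
         \<le> real (ldim (layer_poset n l k))"
proof -
  define m where "m = log 2 (real (n choose k))"
  define a where "a = log 2 (real (n choose l))"
  define d where "d = real (ldim (layer_poset n l k))"
  define c where "c = log 2 (12::real)"
  have "n choose k \<ge> 1" using \<open>k < n\<close> by (simp add: Suc_le_eq)
  then have m0: "m \<ge> 0" using \<open>k < n\<close> by (simp add: m_def Suc_le_eq)
  \<comment> \<open>Pascal's rule gives two positive summands. The resulting
    \<open>a \<ge> 1\<close> makes \<open>log 2 a\<close> nonnegative.\<close>
  have N: "n choose l \<ge> 2"
  proof -
    obtain n' l' where n'l': "n = Suc n'" "l = Suc l'"
      using assms by (metis Suc_le_D less_imp_Suc_add One_nat_def)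
    have "n' choose l' \<ge> 1" "n' choose Suc l' \<ge> 1"
      using assms n'l' by (simp_all add: Suc_le_eq)
    then show ?thesis unfolding n'l' binomial_Suc_Suc by linarith
  qed
  then have "2 \<le> real (n choose l)" by linarith
  then have a1: "a \<ge> 1" unfolding a_def using \<open>l < n\<close>
    by (subst one_le_log_cancel_iff) auto
  have c0: "c \<ge> 0" by (simp add: c_def)
  have "real (n choose k) \<le> (12 * real (n choose l)) ^ ldim (layer_poset n l k)"
  proof (rule order_trans[OF choose_le_power_ldim_layer_poset power_mono])
    show "exp 1 * (2 * real (n choose l)) \<le> 12 * real (n choose l)"
      using exp_le mult_right_mono[of "exp 1" 3 "2 * real (n choose l)"] by simp
  qed (use assms in auto)
  then have "m \<le> log 2 ((12 * real (n choose l)) ^ ldim (layer_poset n l k))"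
    unfolding m_def using \<open>k < n\<close> \<open>l < n\<close> by (subst log_le_cancel_iff) auto
  also have "\<dots> = d * (c + a)"
    unfolding d_def c_def a_def using \<open>l < n\<close> by (subst log_nat_power) (simp_all add: log_mult_pos)
  finally have md: "m \<le> d * (a + c)" by (simp add: add.commute)
  \<comment> \<open>Multiplying \<open>md\<close> by \<open>a - c\<close> turns \<open>a + c\<close>
    into \<open>a\<^sup>2 - c\<^sup>2\<close>; if \<open>a < c\<close>, the left side is at most
    0.\<close>
  have "m * (a - c) \<le> d * a\<^sup>2"
  proof (cases "a \<ge> c")
    case True
    then have "m * (a - c) \<le> d * (a + c) * (a - c)" using md by (intro mult_right_mono) auto
    also have "\<dots> = d * a\<^sup>2 - d * c\<^sup>2" by (simp add: algebra_simps power2_eq_square)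
    also have "\<dots> \<le> d * a\<^sup>2" by (simp add: d_def)
    finally show ?thesis .
  next
    case False
    then have "m * (a - c) \<le> 0" using m0 by (simp add: mult_nonneg_nonpos)
    also have "0 \<le> d * a\<^sup>2" by (simp add: d_def)
    finally show ?thesis .
  qed
  then have "m / a - m / a\<^sup>2 * c \<le> d"
    using a1 by (simp add: field_simps power2_eq_square)
  moreover have "m / a\<^sup>2 * c \<le> m / a\<^sup>2 * (log 2 a + c)"
    using m0 a1 by (intro mult_left_mono) auto
  ultimately show ?thesis unfolding m_def a_def d_def c_def by linarith
qed

text \<open>As \<open>3.585 = 717 / 200\<close>, this amounts to the integer inequality
  \<open>12 ^ 200 < 2 ^ 717\<close>.\<close>

lemma log_2_12_less: "log 2 12 < (3.585::real)"
proof -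
  have "200 * log 2 (12::real) = log 2 (12 ^ 200)" by (subst log_nat_power) simp_all
  also have "\<dots> < log 2 (2 ^ 717)" by (subst log_less_cancel_iff) simp_all
  also have "\<dots> = 717" by (subst log_nat_power) simp_all
  finally show ?thesis by simp
qed

theorem theorem5:
  "(\<exists>c::real. c \<le> log 2 12 \<and> log 2 12 < (3.585::real) \<and>
      (\<forall>n l k :: nat. 1 \<le> l \<and> l < n \<and> k < n \<and> l \<noteq> k \<longrightarrow>
         real (ldim (layer_poset n l k)) \<ge>
           log 2 (real (n choose k)) / log 2 (real (n choose l))
           - log 2 (real (n choose k)) / (log 2 (real (n choose l)))\<^sup>2
             * (log 2 (log 2 (real (n choose l))) + c)))
   \<and> (\<exists>e :: nat \<Rightarrow> real.
        e \<in> O(\<lambda>n. log 2 (log 2 (real n)) / (log 2 (real n))\<^sup>2) \<and>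
        (\<forall>\<^sub>F n in at_top. \<forall>k::nat. k < n \<and> k \<noteq> 1 \<longrightarrow>
           real (ldim (layer_poset n 1 k)) \<ge>
             (1 / log 2 (real n) - e n) * log 2 (real (n choose k))))"
proof (intro conjI exI[of _ "log 2 12"] allI impI)
  \<comment> \<open>The error term for \<open>l = 1\<close>, where \<open>n choose 1 = n\<close>;
    its constant \<open>log 2 12\<close> is absorbed because \<open>log 2 (log 2 n)\<close> tends to
    infinity.\<close>
  let ?e = "\<lambda>n. (log 2 (log 2 (real n)) + log 2 12) / (log 2 (real n))\<^sup>2"
  have bigo: "?e \<in> O(\<lambda>n. log 2 (log 2 (real n)) / (log 2 (real n))\<^sup>2)"
    by real_asymp
  have "(1 / log 2 (real n) - ?e n) * log 2 (real (n choose k)) \<le> real (ldim (layer_poset n 1 k))"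
    if "n \<ge> 2" "k < n" "k \<noteq> 1" for n k
    using ldim_layer_poset_ge[of 1 n k] that by (simp add: algebra_simps add_divide_distrib)
  with bigo show "\<exists>e :: nat \<Rightarrow> real.
        e \<in> O(\<lambda>n. log 2 (log 2 (real n)) / (log 2 (real n))\<^sup>2) \<and>
        (\<forall>\<^sub>F n in at_top. \<forall>k::nat. k < n \<and> k \<noteq> 1 \<longrightarrow>
           real (ldim (layer_poset n 1 k)) \<ge>
             (1 / log 2 (real n) - e n) * log 2 (real (n choose k)))"
    by (intro exI[of _ ?e] conjI eventually_at_top_linorderI[of 2]) auto
qed (use log_2_12_less ldim_layer_poset_ge in auto)

end
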